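(* Let $p>2$ be a prime number. The sequence $IT'$ (the concatenation of $I$ followed by $T'$, as defined in the context) is a $2$-radius sequence of length $p^2+p$ over the $2p$-element alphabet $X=\{0,1,\ldots,p-1\}\cup\{\underline{0},\underline{1},\ldots,\underline{p-1}\}$.
   Context: A sequence $x_1,\ldots,x_m$ over an alphabet $X$ is a $2$-radius sequence if for every $a,b\in X$ there are indices $i,j$ with $x_i=a$, $x_j=b$, $|i-j|\leq 2$. Let $p>2$ be prime. The sets $A=\{0,\ldots,p-1\}$ and $\underline{A}=\{\underline{0},\ldots,\underline{p-1}\}$ are each identified with $\mathbb{Z}_p$; all arithmetic inside an element (e.g. $\underline{a}$ with $a$ an integer expression) is modulo $p$. Let $h=\frac{p-1}{2}$. For $j\in\{1,\ldots,h\}$ define $x^{(j)}_m$ for $m=0,1,\ldots,2p-1$ by $x^{(j)}_m=(mj \bmod p)\in A$ if $m$ is even and $x^{(j)}_m=\underline{mj \bmod p}\in\underline{A}$ if $m$ is odd (so $x^{(j)}_0,\ldots,x^{(j)}_{2p-1}$ is $0,\underline{j},2j,\underline{3j},\ldots$). Let $r_j$ be the unique odd integer in $\{1,\ldots,2p-1\}$ with $r_j j\equiv 1 \pmod p$ (so $x^{(j)}_{r_j}=\underline{1}$). Put $I_j'=x^{(j)}_0,\ldots,x^{(j)}_{r_j-1}$ and $I_j''=x^{(j)}_{r_j},\ldots,x^{(j)}_{2p-1}$. For $j\in\{1,\ldots,h\}$ let $J_j=I_j'$ if $j$ is odd and $J_j=I_j''$ if $j$ is even, and let $\hat J_j=I_j''$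 if $j$ is odd and $\hat J_j=I_j'$ if $j$ is even. Define $I=J_1J_2\cdots J_h\hat J_h\hat J_{h-1}\cdots\hat J_1$ (concatenation). Define $T=(t_1,\ldots,t_{2p})$ by $t_i=\underline{-\frac{i-1}{2}}$ if $i\equiv1\pmod 4$, $t_i=-\frac{i-2}{2}$ if $i\equiv 2\pmod 4$, $t_i=\frac{i+1}{2}$ if $i\equiv 3\pmod 4$, $t_i=\underline{\frac{i}{2}}$ if $i\equiv 0\pmod 4$ (values mod $p$); i.e. $T=\underline{0},0,2,\underline{2},\underline{-2},-2,4,\underline{4},\ldots,-1,\underline{-1},\underline{1},1$. $T'$ is obtained from $T$ by swapping its first two terms. *)

theory Defs
  imports "HOL-Number_Theory.Number_Theory"
begin

definition two_radius_sequence :: "'a set \<Rightarrow> 'a list \<Rightarrow> bool" where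
  "two_radius_sequence X xs \<longleftrightarrow>
     set xs \<subseteq> X \<and>
     (\<forall>a\<in>X. \<forall>b\<in>X. \<exists>i<length xs. \<exists>j<length xs.
        xs ! i = a \<and> xs ! j = b \<and> \<bar>int i - int j\<bar> \<le> 2)"

text \<open>\<open>Underlined k\<close> is the underlined symbol of \<open>k\<close>. Elements of \<open>\<int>/p\<int>\<close> are represented by
  their residues in \<open>{0..<p}\<close>; \<open>plain\<close> and \<open>under\<close> reduce an integer expression.\<close>

datatype letter = Plain int | Underlined int

definition plain :: "nat \<Rightarrow> int \<Rightarrow> letter" where
  "plain p k = Plain (k mod int p)"

definition under :: "nat \<Rightarrow> int \<Rightarrow> letter" where
  "under p k = Underlined (k mod int p)"

definition alphabet :: "nat \<Rightarrow> letter set" where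
  "alphabet p = Plain ` {0..<int p} \<union> Underlined ` {0..<int p}"

definition half :: "nat \<Rightarrow> nat" where
  "half p = (p - 1) div 2"

definition x_term :: "nat \<Rightarrow> nat \<Rightarrow> nat \<Rightarrow> letter" where
  "x_term p j m =
     (if even m then plain p (int m * int j) else under p (int m * int j))"

definition r_index :: "nat \<Rightarrow> nat \<Rightarrow> nat" where
  "r_index p j = (THE r. odd r \<and> r \<in> {1..2 * p - 1} \<and> [r * j = 1] (mod p))"

definition I_first :: "nat \<Rightarrow> nat \<Rightarrow> letter list" where
  "I_first p j = map (x_term p j) [0..<r_index p j]"

definition I_second :: "nat \<Rightarrow> nat \<Rightarrow> letter list" where
  "I_second p j = map (x_term p j) [r_index p j..<2 * p]"

definition J_seq :: "nat \<Rightarrow> nat \<Rightarrow> letter list" where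
  "J_seq p j = (if odd j then I_first p j else I_second p j)"

definition J_hat_seq :: "nat \<Rightarrow> nat \<Rightarrow> letter list" where
  "J_hat_seq p j = (if odd j then I_second p j else I_first p j)"

definition I_seq :: "nat \<Rightarrow> letter list" where
  "I_seq p =
     concat (map (J_seq p) [1..<half p + 1]) @
     concat (map (J_hat_seq p) (rev [1..<half p + 1]))"

text \<open>The index \<open>i\<close> is counted from 1; every \<open>div 2\<close> below is an exact division.\<close>

definition t_term :: "nat \<Rightarrow> nat \<Rightarrow> letter" where
  "t_term p i =
     (if i mod 4 = 1 then under p (- ((int i - 1) div 2))
      else if i mod 4 = 2 then plain p (- ((int i - 2) div 2))
      else if i mod 4 = 3 then plain p ((int i + 1) div 2)
      else under p (int i div 2))"

definition T_seq :: "nat \<Rightarrow> letter list" where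
  "T_seq p = map (t_term p) [1..<2 * p + 1]"

definition T_swapped :: "nat \<Rightarrow> letter list" where
  "T_swapped p = (T_seq p)[0 := T_seq p ! 1, 1 := T_seq p ! 0]"

end

theory Submission
  imports Defs "HOL-Library.Sublist"
begin

text \<open>
  Read cyclically, \<open>x\<^sup>(\<^sup>j\<^sup>)\<close> has every pair of a plain and an underlined letter differing by
  \<open>\<plusminus>j\<close> at distance 1, and every pair of letters of the same kind differing by \<open>\<plusminus>2j\<close> at distance 2.
  So the \<open>h\<close> cyclic sequences together cover all pairs except those of a letter and its underlined
  copy. In \<open>I\<close> every block \<open>I'\<^sub>j\<close> is followed by the underlined 1 that starts all blocks \<open>I''\<close>, and
  every block \<open>I''\<^sub>j\<close> by the plain 0 that starts all blocks \<open>I'\<close> and \<open>T'\<close>; hence cutting the cycles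
  only loses the pairs that jump over the first letter of a block. These are the plain pairs
  \<open>1 - j, 1 + j\<close> and the underlined pairs \<open>-j, j\<close>, whose sums are 2 and 0. They and the pairs of a
  letter and its copy are neighbours in \<open>T\<close>, and remain within distance 2 in \<open>T'\<close>.
\<close>

section \<open>Occurrences at distance at most two\<close>

definition near :: "'a list \<Rightarrow> 'a \<Rightarrow> 'a \<Rightarrow> bool" where
  "near xs a b \<longleftrightarrow> (\<exists>i<length xs. \<exists>j<length xs.
     xs ! i = a \<and> xs ! j = b \<and> \<bar>int i - int j\<bar> \<le> 2)"

lemma nearI:
  assumes "i < length xs" "j < length xs" "xs ! i = a" "xs ! j = b" "i \<le> j + 2" "j \<le> i + 2"
  shows "near xs a b"
proof -
  have "\<bar>int i - int j\<bar> \<le> 2" using assms by linarith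
  then show ?thesis using assms unfolding near_def by blast
qed

lemma near_sym: "near xs a b \<Longrightarrow> near xs b a"
  unfolding near_def by (metis abs_minus_commute)

lemma near_refl: "near xs a b \<Longrightarrow> near xs a a"
  unfolding near_def by force

lemma near_sublist:
  assumes "near xs a b" "sublist xs ys"
  shows "near ys a b"
proof -
  obtain us vs where ys: "ys = us @ xs @ vs"
    using assms(2) by (auto simp: sublist_def)
  obtain i j where ij: "i < length xs" "j < length xs" "xs ! i = a" "xs ! j = b"
      "\<bar>int i - int j\<bar> \<le> 2"
    using assms(1) unfolding near_def by blast
  show ?thesis
    by (rule nearI[of "length us + i" _ "length us + j"])
      (use ij in \<open>auto simp: ys nth_append\<close>)
qed

lemma near_map_upt:
  assumes "l \<le> m" "m < u" "l \<le> n" "n < u" "m \<le> n + 2" "n \<le> m + 2"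
  shows "near (map f [l..<u]) (f m) (f n)"
  by (rule nearI[of "m - l" _ "n - l"]) (use assms in auto)

lemma two_radius_sequence_iff_near:
  "two_radius_sequence X xs \<longleftrightarrow> set xs \<subseteq> X \<and> (\<forall>a\<in>X. \<forall>b\<in>X. near xs a b)"
  by (simp add: two_radius_sequence_def near_def)

text \<open>Close pairs can reach past the end of a block, so the letter after it is kept. That
  letter \<open>c\<close> is the head of all that follows \<open>f k\<close>, whether a later block
  or \<open>t\<close> supplies it.\<close>

lemma sublist_concat_upt:
  assumes "k < n" and "concat (map f [Suc k..<n]) @ t = c # s"
  shows "sublist (f k @ [c]) (concat (map f [0..<n]) @ t)"
proof -
  have "[0..<n] = [0..<k] @ k # [Suc k..<n]"
    using assms(1) upt_add_eq_append[of 0 k "n - k"] by (simp add: upt_conv_Cons)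
  then have "concat (map f [0..<n]) @ t = concat (map f [0..<k]) @ (f k @ [c]) @ s"
    using assms(2) by simp
  then show ?thesis by (simp only: sublist_appendI)
qed

section \<open>Letters as residue classes, and the alphabet\<close>

lemma plain_eq_iff: "plain p k = plain p l \<longleftrightarrow> [k = l] (mod int p)"
  by (simp add: plain_def cong_def)

lemma under_eq_iff: "under p k = under p l \<longleftrightarrow> [k = l] (mod int p)"
  by (simp add: under_def cong_def)

lemma letter_cong:
  assumes "[k = l] (mod int p)"
  shows "plain p k = plain p l" "under p k = under p l"
  using assms by (simp_all add: plain_eq_iff under_eq_iff)

lemma alphabet_cases:
  assumes "a \<in> alphabet p"
  obtains k where "a = plain p k" "0 \<le> k" "k < int p"
    | k where "a = under p k" "0 \<le> k" "k < int p"
proof -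
  from assms consider k where "a = Plain k" "0 \<le> k" "k < int p"
    | k where "a = Underlined k" "0 \<le> k" "k < int p"
    by (auto simp: alphabet_def)
  then show thesis
    by cases (use that in \<open>auto simp: plain_def under_def\<close>)
qed

lemma plain_in_alphabet: "p > 0 \<Longrightarrow> plain p k \<in> alphabet p"
  by (simp add: alphabet_def plain_def)

lemma under_in_alphabet: "p > 0 \<Longrightarrow> under p k \<in> alphabet p"
  by (simp add: alphabet_def under_def)

lemma card_alphabet: "card (alphabet p) = 2 * p"
proof -
  have "card (alphabet p) = card (Plain ` {0..<int p}) + card (Underlined ` {0..<int p})"
    unfolding alphabet_def by (rule card_Un_disjoint) auto
  then show ?thesis
    by (simp add: card_image inj_on_def)
qed

section \<open>I as one list of alternating blocks\<close>

definition block_index :: "nat \<Rightarrow> nat \<Rightarrow> nat" where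
  "block_index p k = (if k < half p then k + 1 else 2 * half p - k)"

text \<open>The index \<open>j\<close> at position \<open>k\<close> has the opposite parity of
  \<open>k\<close> in the first half of I and the same parity in the second, while
  \<open>J_hat_seq\<close> reverses the rule of \<open>J_seq\<close>. Hence the parity of
  \<open>k\<close> alone decides the kind of block, and the kinds alternate throughout.\<close>

definition block :: "nat \<Rightarrow> nat \<Rightarrow> letter list" where
  "block p k =
     (if even k then I_first p (block_index p k) else I_second p (block_index p k))"

lemma I_seq_eq_blocks: "I_seq p = concat (map (block p) [0..<2 * half p])"
proof -
  let ?h = "half p"
  have "map (J_seq p) [1..<?h + 1] = map (block p) [0..<?h]"
    by (rule nth_equalityI) (auto simp: J_seq_def block_def block_index_def simp del: upt_Suc)
  moreover have "map (J_hat_seq p) (rev [1..<?h + 1]) = map (block p) [?h..<2 * ?h]"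
    by (rule nth_equalityI)
      (auto simp: J_hat_seq_def block_def block_index_def rev_nth Suc_diff_Suc simp del: upt_Suc)
  moreover have "[0..<2 * ?h] = [0..<?h] @ [?h..<2 * ?h]"
    using upt_add_eq_append[of 0 ?h ?h] by (simp add: mult_2)
  ultimately show ?thesis
    by (simp add: I_seq_def)
qed

context
  fixes p :: nat
  assumes prime_p: "prime p" and p_gt_2: "p > 2"
begin

section \<open>The cyclic sequences and their cuts\<close>

lemma odd_p: "odd p"
  using prime_p p_gt_2 prime_odd_nat by blast

lemma two_half: "2 * half p = p - 1"
  using odd_p by (simp add: half_def)

lemma coprime_index:
  assumes "j \<in> {1..half p}"
  shows "coprime j p"
proof -
  have "\<not> p dvd j"
    using assms two_half p_gt_2 by (auto dest!: dvd_imp_le)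
  then show ?thesis
    using prime_p prime_imp_coprime coprime_commute by blast
qed

text \<open>As \<open>j\<close> is invertible, the congruence fixes \<open>m\<close> modulo
  \<open>p\<close>; as \<open>p\<close> is odd, the Chinese remainder theorem adds the parity. So
  each letter occurs exactly once in a cycle, a plain one for \<open>e = True\<close> and an
  underlined one for \<open>e = False\<close>.\<close>

lemma ex1_parity_residue:
  assumes "j \<in> {1..half p}"
  shows "\<exists>!m. m < 2 * p \<and> even m = e \<and> [int m * int j = c] (mod int p)"
proof -
  have cop: "coprime (int j) (int p)"
    using coprime_index[OF assms] by simp
  then obtain i where i: "[int j * i = 1] (mod int p)"
    using cong_solve_coprime_int by blast
  \<comment> \<open>The quotient of \<open>c\<close> by \<open>j\<close> modulo
    \<open>p\<close>.\<close>
  define u where "u = nat ((i * c) mod int p)"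
  have u: "int u = (i * c) mod int p"
    using p_gt_2 by (simp add: u_def)
  have iff: "[int m * int j = c] (mod int p) \<longleftrightarrow> [m = u] (mod p)" for m
  proof -
    have "[int u * int j = (int j * i) * c] (mod int p)"
      by (simp add: u cong_def mod_mult_right_eq mod_mult_left_eq ac_simps)
    also have "[(int j * i) * c = 1 * c] (mod int p)"
      using i by (rule cong_scalar_right)
    finally have "[int u * int j = c] (mod int p)" by simp
    then have "[int m * int j = c] (mod int p) \<longleftrightarrow> [int m * int j = int u * int j] (mod int p)"
      by (meson cong_sym cong_trans)
    also have "\<dots> \<longleftrightarrow> [int m = int u] (mod int p)"
      using cop by (rule cong_mult_rcancel)
    finally show ?thesis by (simp add: cong_int_iff)
  qed
  have par: "even m = e \<longleftrightarrow> [m = of_bool (\<not> e)] (mod 2)" for m :: nat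
    by (cases e) (auto simp: cong_def even_iff_mod_2_eq_zero odd_iff_mod_2_eq_one)
  have "coprime p 2" using odd_p by simp
  then have "\<exists>!m. m < p * 2 \<and> [m = u] (mod p) \<and> [m = of_bool (\<not> e)] (mod 2)"
    using p_gt_2 by (intro binary_chinese_remainder_unique_nat) auto
  then show ?thesis
    unfolding iff par by (simp add: conj_commute conj_left_commute mult.commute)
qed

text \<open>The predicate under the definite description is the case \<open>e = False\<close>,
  \<open>c = 1\<close> of \<open>ex1_parity_residue\<close>, which makes \<open>theI'\<close>
  applicable.\<close>

lemma r_index:
  assumes "j \<in> {1..half p}"
  shows "odd (r_index p j)" "r_index p j < 2 * p" "[int (r_index p j) * int j = 1] (mod int p)"
proof -
  have iff: "odd r \<and> r \<in> {1..2 * p - 1} \<and> [r * j = 1] (mod p) \<longleftrightarrow>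
      r < 2 * p \<and> even r = False \<and> [int r * int j = 1] (mod int p)" for r
  proof -
    have "[r * j = 1] (mod p) \<longleftrightarrow> [int r * int j = 1] (mod int p)"
      using cong_int_iff[of "r * j" 1 p] by simp
    moreover have "odd r \<Longrightarrow> r \<in> {1..2 * p - 1} \<longleftrightarrow> r < 2 * p"
      using p_gt_2 by (auto simp: Suc_le_eq odd_pos)
    ultimately show ?thesis by blast
  qed
  show "odd (r_index p j)" "r_index p j < 2 * p" "[int (r_index p j) * int j = 1] (mod int p)"
    using theI'[OF ex1_parity_residue[OF assms, of False 1]]
    unfolding r_index_def iff by simp_all
qed

text \<open>Closes the cycle: index \<open>2 * p\<close> is one past the end and stands for the
  first letter read again.\<close>

lemma x_term_double_p: "x_term p j (2 * p) = x_term p j 0"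
  by (simp add: x_term_def plain_eq_iff cong_def)

lemma x_term_0: "x_term p j 0 = plain p 0"
  by (simp add: x_term_def)

lemma x_term_r_index: "j \<in> {1..half p} \<Longrightarrow> x_term p j (r_index p j) = under p 1"
  using r_index by (simp add: x_term_def under_eq_iff)

text \<open>The first letter of the following block extends the index range to the cut itself, so
  pairs ending there are kept.\<close>

lemma I_first_snoc:
  "j \<in> {1..half p} \<Longrightarrow> I_first p j @ [under p 1] = map (x_term p j) [0..<Suc (r_index p j)]"
  by (simp add: I_first_def x_term_r_index)

lemma I_second_snoc:
  "j \<in> {1..half p} \<Longrightarrow> I_second p j @ [plain p 0] = map (x_term p j) [r_index p j..<Suc (2 * p)]"
  using r_index(2)[of j] by (simp add: I_second_def x_term_double_p x_term_0 less_imp_le_nat)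

lemma I_first_Cons:
  assumes "j \<in> {1..half p}"
  shows "\<exists>s. I_first p j = plain p 0 # s"
  using r_index(1)[OF assms] by (auto simp: I_first_def upt_conv_Cons odd_pos x_term_0)

lemma I_second_Cons:
  assumes "j \<in> {1..half p}"
  shows "\<exists>s. I_second p j = under p 1 # s"
  using r_index(2)[OF assms] assms by (auto simp: I_second_def upt_conv_Cons x_term_r_index)

lemma block_index: "k < 2 * half p \<Longrightarrow> block_index p k \<in> {1..half p}"
  by (auto simp: block_index_def)

section \<open>The sequence T'\<close>

lemma T_swapped_nth:
  assumes "i < 2 * p"
  shows "T_swapped p ! i = t_term p (if i = 0 then 2 else if i = 1 then 1 else i + 1)"
  using assms p_gt_2 by (auto simp: T_swapped_def T_seq_def nth_list_update numeral_2_eq_2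
      simp del: upt_Suc)

lemma length_T_swapped: "length (T_swapped p) = 2 * p"
  by (simp add: T_swapped_def T_seq_def del: upt_Suc)

text \<open>The purpose of the swap: T begins with the underlined 0, but the last block of I must be
  followed by the plain 0.\<close>

lemma T_swapped_Cons: "\<exists>s. T_swapped p = plain p 0 # s"
proof (cases "T_swapped p")
  case Nil
  then show ?thesis using length_T_swapped p_gt_2 by simp
next
  case (Cons a s)
  then have "a = T_swapped p ! 0" by simp
  also have "\<dots> = plain p 0"
    using p_gt_2 by (simp add: T_swapped_nth t_term_def)
  finally show ?thesis using Cons by simp
qed

text \<open>The swap separates only the terms numbered 2 and 3, and these move to positions 0 and
  2.\<close>

lemma near_T_swapped:
  assumes "1 \<le> i" "i < 2 * p"
  shows "near (T_swapped p) (t_term p i) (t_term p (i + 1))"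
proof -
  \<comment> \<open>\<open>f i\<close> is the position in T', counted from 0, of the term numbered
    \<open>i\<close> from 1.\<close>
  define f where "f i = (if i = 1 then 1 else if i = 2 then 0 else i - 1)" for i :: nat
  have f: "f i < 2 * p \<and> T_swapped p ! f i = t_term p i" if "1 \<le> i" "i \<le> 2 * p" for i
    using that p_gt_2 by (auto simp: f_def T_swapped_nth)
  show ?thesis
    by (rule nearI[of "f i" _ "f (i + 1)"])
      (use assms f[of i] f[of "i + 1"] in \<open>auto simp: length_T_swapped f_def\<close>)
qed

section \<open>Blocks together with the next letter\<close>

lemma sublist_block:
  assumes "k < 2 * half p"
  shows "sublist (block p k @ [if even k then under p 1 else plain p 0]) (I_seq p @ T_swapped p)"
proof -
  have "\<exists>s. concat (map (block p) [Suc k..<2 * half p]) @ T_swapped p =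
      (if even k then under p 1 else plain p 0) # s"
  proof (cases "Suc k < 2 * half p")
    case True
    then have "block_index p (Suc k) \<in> {1..half p}" by (rule block_index)
    then obtain s s' where "I_first p (block_index p (Suc k)) = plain p 0 # s"
        "I_second p (block_index p (Suc k)) = under p 1 # s'"
      using I_first_Cons I_second_Cons by blast
    then show ?thesis using True by (simp add: upt_conv_Cons block_def)
  next
    case False
    then have "Suc k = 2 * half p" using assms by simp
    \<comment> \<open>The number of blocks is even, so the last one is of the second kind and T'
      supplies the plain 0 after it.\<close>
    then have "odd k" by (metis even_Suc dvd_triv_left)
    then show ?thesis using False T_swapped_Cons by simp
  qed
  then show ?thesis
    unfolding I_seq_eq_blocks by (auto intro: sublist_concat_upt[OF assms])
qed

lemma sublist_I_first:
  assumes "j \<in> {1..half p}"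
  shows "sublist (map (x_term p j) [0..<Suc (r_index p j)]) (I_seq p @ T_swapped p)"
proof -
  \<comment> \<open>Index \<open>j\<close> sits at the positions \<open>j - 1\<close> and
    \<open>2 * half p - j\<close>, whose sum is odd; the even one holds
    \<open>I_first p j\<close>.\<close>
  define k where "k = (if odd j then j - 1 else 2 * half p - j)"
  have "k < 2 * half p" "even k" "block_index p k = j"
    using assms by (auto simp: k_def block_index_def)
  then show ?thesis
    using sublist_block[of k] I_first_snoc[OF assms] by (simp add: block_def)
qed

lemma sublist_I_second:
  assumes "j \<in> {1..half p}"
  shows "sublist (map (x_term p j) [r_index p j..<Suc (2 * p)]) (I_seq p @ T_swapped p)"
proof -
  define k where "k = (if even j then j - 1 else 2 * half p - j)"
  have "k < 2 * half p" "odd k" "block_index p k = j"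
    using assms by (auto simp: k_def block_index_def)
  then show ?thesis
    using sublist_block[of k] I_second_snoc[OF assms] by (simp add: block_def)
qed

abbreviation near_IT :: "letter \<Rightarrow> letter \<Rightarrow> bool" where
  "near_IT \<equiv> near (I_seq p @ T_swapped p)"

text \<open>The last assumption excludes just the pair jumping over the cut,
  \<open>m = r_index p j - 1\<close> and \<open>n = r_index p j + 1\<close>; otherwise both
  positions lie in one extended block.\<close>

lemma near_x_term:
  assumes "j \<in> {1..half p}" "m \<le> n" "n \<le> m + 2" "n \<le> 2 * p"
    and "n \<le> r_index p j \<or> r_index p j \<le> m"
  shows "near_IT (x_term p j m) (x_term p j n)"
  using assms(5)
proof
  assume "n \<le> r_index p j"
  then have "near (map (x_term p j) [0..<Suc (r_index p j)]) (x_term p j m) (x_term p j n)"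
    using assms by (intro near_map_upt) auto
  then show ?thesis by (rule near_sublist[OF _ sublist_I_first[OF assms(1)]])
next
  assume "r_index p j \<le> m"
  then have "near (map (x_term p j) [r_index p j..<Suc (2 * p)]) (x_term p j m) (x_term p j n)"
    using assms by (intro near_map_upt) auto
  then show ?thesis by (rule near_sublist[OF _ sublist_I_second[OF assms(1)]])
qed

lemma near_t_term:
  assumes "1 \<le> i" "i < 2 * p"
  shows "near_IT (t_term p i) (t_term p (i + 1))"
  using near_T_swapped[OF assms] sublist_append_leftI by (rule near_sublist)

section \<open>Pairs found in the cyclic sequences\<close>

lemma ex_index_abs:
  assumes "\<not> [d = 0] (mod int p)"
  obtains j where "j \<in> {1..half p}" "[d = int j] (mod int p) \<or> [d = - int j] (mod int p)"
proof -
  define e where "e = d mod int p"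
  have e: "0 < e" "e < int p" "[d = e] (mod int p)"
    using assms p_gt_2 pos_mod_sign[of "int p" d] by (auto simp: e_def cong_def order_less_le[of 0])
  show ?thesis
  proof (cases "e \<le> int (half p)")
    case True
    then show ?thesis using e by (intro that[of "nat e"]) auto
  next
    case False
    have "[d = - int (nat (int p - e))] (mod int p)"
      using e by (simp add: cong_def)
    moreover have "nat (int p - e) \<in> {1..half p}"
      using False e two_half p_gt_2 by auto
    ultimately show ?thesis using that by blast
  qed
qed

text \<open>No position lies strictly between \<open>m\<close> and \<open>Suc m\<close>, so cutting
  loses no pair at distance one. The two claims start at an even and at an odd position.\<close>

lemma near_succ:
  assumes "j \<in> {1..half p}"
  shows "near_IT (plain p a) (under p (a + int j))" "near_IT (under p a) (plain p (a + int j))"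
proof -
  have step: "near_IT (x_term p j m) (x_term p j (Suc m))" if "m < 2 * p" for m
    using that assms by (intro near_x_term) auto
  obtain m where m: "m < 2 * p" "even m" "[int m * int j = a] (mod int p)"
    using ex1_parity_residue[OF assms, of True a] by blast
  have "[int (Suc m) * int j = a + int j] (mod int p)"
    using cong_add[OF m(3) cong_refl[of "int j"]] by (simp add: algebra_simps)
  then show "near_IT (plain p a) (under p (a + int j))"
    using step[of m] m(1,2) letter_cong[OF m(3)]
      letter_cong[OF \<open>[int (Suc m) * int j = a + int j] (mod int p)\<close>]
    by (simp add: x_term_def del: of_nat_Suc)
  obtain n where n: "n < 2 * p" "odd n" "[int n * int j = a] (mod int p)"
    using ex1_parity_residue[OF assms, of False a] by blast
  have "[int (Suc n) * int j = a + int j] (mod int p)"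
    using cong_add[OF n(3) cong_refl[of "int j"]] by (simp add: algebra_simps)
  then show "near_IT (under p a) (plain p (a + int j))"
    using step[of n] n(1,2) letter_cong[OF n(3)]
      letter_cong[OF \<open>[int (Suc n) * int j = a + int j] (mod int p)\<close>]
    by (simp add: x_term_def del: of_nat_Suc)
qed

text \<open>The excluded values belong to the letters from which a jump over a block start begins:
  the plain \<open>1 - j\<close> before the underlined 1, and the underlined \<open>- j\<close>
  before the plain 0 at \<open>2 * p\<close>.\<close>

lemma near_succ2:
  assumes "j \<in> {1..half p}"
  shows "\<not> [a = 1 - int j] (mod int p) \<Longrightarrow> near_IT (plain p a) (plain p (a + 2 * int j))"
    and "\<not> [a = - int j] (mod int p) \<Longrightarrow> near_IT (under p a) (under p (a + 2 * int j))"
proof -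
  have shift: "[int (m + 2) * int j = a + 2 * int j] (mod int p)"
    if "[int m * int j = a] (mod int p)" for m
    using cong_add[OF that cong_refl[of "2 * int j"]] by (simp add: algebra_simps)
  show "near_IT (plain p a) (plain p (a + 2 * int j))" if a: "\<not> [a = 1 - int j] (mod int p)"
  proof -
    obtain m where m: "m < 2 * p" "even m" "[int m * int j = a] (mod int p)"
      using ex1_parity_residue[OF assms, of True a] by blast
    have "m + 1 \<noteq> r_index p j"
    proof
      assume "m + 1 = r_index p j"
      then have "[int m * int j + int j = 1] (mod int p)"
        using r_index(3)[OF assms] by (simp flip: \<open>m + 1 = _\<close> add: algebra_simps)
      then have "[int m * int j = 1 - int j] (mod int p)"
        by (simp add: cong_iff_dvd_diff algebra_simps)
      then show False using a m(3) cong_sym cong_trans by blast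
    qed
    moreover have "m + 2 \<le> 2 * p" using m by presburger
    ultimately have "near_IT (x_term p j m) (x_term p j (m + 2))"
      using assms by (intro near_x_term) auto
    then show ?thesis
      using m(2) letter_cong[OF m(3)] letter_cong[OF shift[OF m(3)]]
      by (simp add: x_term_def del: of_nat_add of_nat_Suc add_2_eq_Suc')
  qed
  show "near_IT (under p a) (under p (a + 2 * int j))" if a: "\<not> [a = - int j] (mod int p)"
  proof -
    obtain m where m: "m < 2 * p" "odd m" "[int m * int j = a] (mod int p)"
      using ex1_parity_residue[OF assms, of False a] by blast
    \<comment> \<open>From \<open>m = 2 * p - 1\<close> the step would leave the closed cycle; the
      value there is \<open>- j\<close>.\<close>
    have "m + 1 \<noteq> 2 * p"
    proof
      assume "m + 1 = 2 * p"
      then have m_eq: "int m = 2 * int p - 1" by linarith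
      have "int m * int j - - int j = int p * (2 * int j)"
        unfolding m_eq by (simp add: algebra_simps)
      then have "[int m * int j = - int j] (mod int p)"
        unfolding cong_iff_dvd_diff by (rule dvdI)
      then show False using a m(3) cong_sym cong_trans by blast
    qed
    \<comment> \<open>An underlined pair jumps over an even position, but the cut is at an odd
      one.\<close>
    moreover have "m + 1 \<noteq> r_index p j"
      using m(2) r_index(1)[OF assms] by presburger
    ultimately have "near_IT (x_term p j m) (x_term p j (m + 2))"
      using m assms by (intro near_x_term) auto
    then show ?thesis
      using m(2) letter_cong[OF m(3)] letter_cong[OF shift[OF m(3)]]
      by (simp add: x_term_def del: of_nat_add of_nat_Suc add_2_eq_Suc')
  qed
qed

section \<open>Pairs found in T'\<close>

lemma t_term_even:
  assumes "even c"
  shows "t_term p (2 * c + 1) = under p (- int c)" "t_term p (2 * c + 2) = plain p (- int c)"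
    "t_term p (2 * c + 3) = plain p (int c + 2)" "t_term p (2 * c + 4) = under p (int c + 2)"
proof -
  \<comment> \<open>T runs in groups of four terms, numbered \<open>4 * k + 1\<close> to
    \<open>4 * k + 4\<close>; the even number \<open>c = 2 * k\<close> labels a group.\<close>
  obtain k where "c = 2 * k" using assms by blast
  moreover have "(4 * k + 1) mod 4 = 1" "(4 * k + 2) mod 4 = 2" "(4 * k + 3) mod 4 = 3"
      "(4 * k + 4) mod 4 = 0"
    by presburger+
  ultimately show "t_term p (2 * c + 1) = under p (- int c)"
    "t_term p (2 * c + 2) = plain p (- int c)"
    "t_term p (2 * c + 3) = plain p (int c + 2)" "t_term p (2 * c + 4) = under p (int c + 2)"
    by (simp_all add: t_term_def add.commute)
qed

text \<open>For an odd residue \<open>e\<close> the number \<open>p - e\<close> is even, because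
  \<open>p\<close> is odd. Even labels \<open>c\<close> thus reach every residue up to sign.\<close>

lemma ex_even_abs:
  obtains c where "even c" "c < p" "[a = int c] (mod int p) \<or> [a = - int c] (mod int p)"
proof -
  define e where "e = nat (a mod int p)"
  have e: "e < p" "[a = int e] (mod int p)"
    using p_gt_2 by (auto simp: e_def cong_def nat_less_iff)
  show ?thesis
  proof (cases "even e")
    case True
    then show ?thesis using e that by blast
  next
    case False
    have "[a = - int (p - e)] (mod int p)"
      using e by (simp add: cong_def of_nat_diff)
    moreover have "even (p - e)" "p - e < p"
      using False odd_p e by (auto simp: odd_pos)
    ultimately show ?thesis using that by blast
  qed
qed

text \<open>For \<open>c > 0\<close> the claims concern the terms numbered \<open>2 * c + 1\<close>,
  \<open>2 * c + 2\<close>, \<open>2 * c - 1\<close> and \<open>2 * c\<close>, each with its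
  successor. For \<open>c = p - 1\<close> the second would run past the end of T.\<close>

lemma near_t_term_even:
  assumes "even c" "c < p"
  shows "near_IT (under p (- int c)) (plain p (- int c))"
    and "c + 2 < p \<Longrightarrow> near_IT (plain p (- int c)) (plain p (int c + 2))"
    and "near_IT (plain p (int c)) (under p (int c))"
    and "near_IT (under p (int c)) (under p (- int c))"
proof -
  show *: "near_IT (under p (- int c)) (plain p (- int c))"
    using near_t_term[of "2 * c + 1"] t_term_even[OF assms(1)] assms(2) by simp
  show "c + 2 < p \<Longrightarrow> near_IT (plain p (- int c)) (plain p (int c + 2))"
    using near_t_term[of "2 * c + 2"] t_term_even[OF assms(1)] by (simp add: numeral_3_eq_3)
  have "near_IT (plain p (int c)) (under p (int c)) \<and>
      near_IT (under p (int c)) (under p (- int c))"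
  proof (cases "c = 0")
    case True
    \<comment> \<open>No group precedes \<open>c = 0\<close>; since \<open>- 0 = 0\<close>, the
      opening pair of zeros gives both claims.\<close>
    then show ?thesis using near_sym[OF *] near_refl[OF *] by simp
  next
    case False
    then have "2 \<le> c" using assms(1) by presburger
    then obtain d where d: "c = d + 2" by (metis le_add_diff_inverse2)
    then have "even d" using assms(1) by simp
    then show ?thesis
      using near_t_term[of "2 * d + 3"] near_t_term[of "2 * d + 4"]
        t_term_even(3,4)[OF \<open>even d\<close>] t_term_even(1)[OF assms(1)] assms(2) d
      by (simp add: eval_nat_numeral add.commute)
  qed
  then show "near_IT (plain p (int c)) (under p (int c))"
    "near_IT (under p (int c)) (under p (- int c))" by auto
qed

lemma near_plain_under_same: "near_IT (plain p a) (under p a)"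
proof -
  obtain c where c: "even c" "c < p" "[a = int c] (mod int p) \<or> [a = - int c] (mod int p)"
    by (rule ex_even_abs)
  then have "(plain p a = plain p (int c) \<and> under p a = under p (int c)) \<or>
      (plain p a = plain p (- int c) \<and> under p a = under p (- int c))"
    by (simp add: plain_eq_iff under_eq_iff)
  then show ?thesis using near_t_term_even[OF c(1,2)] near_sym by metis
qed

text \<open>Recovers the underlined pairs lost around the plain 0: for \<open>c > 0\<close>, the
  underlined \<open>c\<close> and \<open>- c\<close> meet where two groups of T join.\<close>

lemma near_under_opposite:
  assumes "[a + b = 0] (mod int p)"
  shows "near_IT (under p a) (under p b)"
proof -
  obtain c where c: "even c" "c < p" "[a = int c] (mod int p) \<or> [a = - int c] (mod int p)"
    by (rule ex_even_abs)
  have b: "[b = - a] (mod int p)"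
    using assms by (simp add: cong_iff_dvd_diff add.commute)
  from c(3) show ?thesis
  proof
    assume a: "[a = int c] (mod int p)"
    then have "[b = - int c] (mod int p)"
      using cong_trans[OF b, of "- int c"] by (simp add: cong_minus_minus_iff)
    then show ?thesis
      using near_t_term_even(4)[OF c(1,2)] letter_cong(2)[OF a] letter_cong(2)[of b] by simp
  next
    assume a: "[a = - int c] (mod int p)"
    then have "[b = int c] (mod int p)"
      using cong_trans[OF b, of "int c"] cong_minus_minus_iff[of a "- int c"] by simp
    then show ?thesis
      using near_sym[OF near_t_term_even(4)[OF c(1,2)]] letter_cong(2)[OF a] letter_cong(2)[of b]
      by simp
  qed
qed

text \<open>Recovers the plain pairs lost around the underlined 1: the two plain terms within a
  group of T are \<open>- c\<close> and \<open>c + 2\<close>.\<close>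

lemma near_plain_sum_2:
  assumes "[a + b = 2] (mod int p)"
  shows "near_IT (plain p a) (plain p b)"
proof -
  have key: "near_IT (plain p a) (plain p b)"
    if c: "even c" "c < p" "[a = - int c] (mod int p)" and ab: "[a + b = 2] (mod int p)"
    for a b c
  proof -
    have "[(a + b) - a = 2 - (- int c)] (mod int p)"
      using ab c(3) by (rule cong_diff)
    then have b: "[b = int c + 2] (mod int p)" by (simp add: add.commute)
    show ?thesis
    proof (cases "c + 2 < p")
      case True
      then show ?thesis
        using near_t_term_even(2)[OF c(1,2)] letter_cong(1)[OF c(3)] letter_cong(1)[OF b] by simp
    next
      case False
      \<comment> \<open>Parity leaves only \<open>c = p - 1\<close>, the incomplete last group;
        there \<open>a\<close> and \<open>b\<close> are both 1 modulo \<open>p\<close>, a single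
        letter.\<close>
      then have "int p = int c + 1" using c odd_p by presburger
      then have "- int c - 1 = int p * - 1" "int c + 2 - 1 = int p * 1" by simp_all
      then have "[- int c = 1] (mod int p)" "[int c + 2 = 1] (mod int p)"
        unfolding cong_iff_dvd_diff by (auto simp only: dvd_triv_left)
      then have "plain p a = plain p b"
        using cong_trans[OF c(3)] cong_trans[OF b] letter_cong(1)[of a 1] letter_cong(1)[of b 1]
        by simp
      then show ?thesis using near_refl[OF near_plain_under_same, of a] by simp
    qed
  qed
  obtain c where c: "even c" "c < p" "[a = int c] (mod int p) \<or> [a = - int c] (mod int p)"
    by (rule ex_even_abs)
  from c(3) show ?thesis
  proof
    assume a: "[a = - int c] (mod int p)"
    show ?thesis by (rule key[OF c(1,2) a assms])
  next
    assume a: "[a = int c] (mod int p)"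
    show ?thesis
    proof (cases "c = 0")
      case True
      then show ?thesis using key[of 0 a b] a assms p_gt_2 by simp
    next
      case False
      then have "2 \<le> c" using c(1) by presburger
      \<comment> \<open>Modulo \<open>p\<close>, now \<open>b = - d\<close> and
        \<open>a = d + 2\<close>, so \<open>key\<close> applies with the two letters
        exchanged.\<close>
      then obtain d where d: "c = d + 2" by (metis le_add_diff_inverse2)
      then have "even d" using c(1) by simp
      have "[(a + b) - a = 2 - int c] (mod int p)"
        using assms a by (rule cong_diff)
      then have "[b = - int d] (mod int p)" using d by simp
      then show ?thesis
        using key[of d b a] d \<open>even d\<close> c assms near_sym by (simp add: add.commute)
    qed
  qed
qed

section \<open>All pairs of letters\<close>

lemma near_plain_under: "near_IT (plain p a) (under p b)"
proof (cases "[b - a = 0] (mod int p)")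
  case True
  then have "under p b = under p a" by (simp add: under_eq_iff cong_diff_iff_cong_0)
  then show ?thesis using near_plain_under_same by simp
next
  case False
  then obtain j where j: "j \<in> {1..half p}"
      "[b - a = int j] (mod int p) \<or> [b - a = - int j] (mod int p)"
    by (rule ex_index_abs)
  from j(2) show ?thesis
  proof
    assume "[b - a = int j] (mod int p)"
    then have "[b = a + int j] (mod int p)" by (simp add: cong_iff_dvd_diff algebra_simps)
    then show ?thesis using near_succ(1)[OF j(1), of a] by (simp flip: under_eq_iff)
  next
    assume "[b - a = - int j] (mod int p)"
    then have "[a = b + int j] (mod int p)"
      by (simp add: cong_iff_dvd_diff algebra_simps dvd_diff_commute)
    then show ?thesis using near_sym[OF near_succ(2)[OF j(1), of b]] by (simp flip: plain_eq_iff)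
  qed
qed

text \<open>The difference is halved modulo the odd \<open>p\<close> and then reduced to least
  absolute value; the sign decides from which side the step \<open>2 * int j\<close> is
  taken.\<close>

lemma ex_index_twice_abs:
  assumes "\<not> [a = b] (mod int p)"
  obtains j where "j \<in> {1..half p}"
    "[b = a + 2 * int j] (mod int p) \<or> [a = b + 2 * int j] (mod int p)"
proof -
  obtain i where "[2 * i = 1] (mod int p)"
    using odd_p cong_solve_coprime_int[of 2 "int p"] by auto
  then have "[2 * i * (b - a) = 1 * (b - a)] (mod int p)"
    by (rule cong_scalar_right)
  then have d: "[b - a = 2 * (i * (b - a))] (mod int p)"
    by (simp add: cong_sym mult.assoc)
  then have "\<not> [i * (b - a) = 0] (mod int p)"
    using assms by (metis cong_diff_iff_cong_0 cong_scalar_left cong_sym cong_trans mult_zero_right)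
  then obtain j where j: "j \<in> {1..half p}"
      "[i * (b - a) = int j] (mod int p) \<or> [i * (b - a) = - int j] (mod int p)"
    by (rule ex_index_abs)
  then have "[b - a = 2 * int j] (mod int p) \<or> [b - a = 2 * - int j] (mod int p)"
    using d cong_scalar_left cong_trans by blast
  then have "[b = a + 2 * int j] (mod int p) \<or> [a = b + 2 * int j] (mod int p)"
    by (auto simp: cong_iff_dvd_diff algebra_simps dvd_diff_commute)
  then show ?thesis using that j(1) by blast
qed

text \<open>A plain step of \<open>2 * int j\<close> can be missing from the cycles only if it
  starts at \<open>1 - int j\<close>, and then the sum is 2, the case settled by T'.\<close>

lemma near_plain_plain: "near_IT (plain p a) (plain p b)"
proof (cases "[a + b = 2] (mod int p)")
  case True
  then show ?thesis by (rule near_plain_sum_2)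
next
  case sum: False
  have key: "near_IT (plain p a) (plain p b)"
    if "\<not> [a + b = 2] (mod int p)" "j \<in> {1..half p}" "[b = a + 2 * int j] (mod int p)" for a b j
  proof -
    have "\<not> [a = 1 - int j] (mod int p)"
    proof
      assume "[a = 1 - int j] (mod int p)"
      then have "[a + (a + 2 * int j) = (1 - int j) + ((1 - int j) + 2 * int j)] (mod int p)"
        by (intro cong_add cong_refl)
      then have "[a + (a + 2 * int j) = 2] (mod int p)" by simp
      then show False
        using that cong_add[OF cong_refl that(3)] cong_trans by blast
    qed
    then show ?thesis
      using near_succ2(1)[of j a] that by (simp flip: plain_eq_iff)
  qed
  show ?thesis
  proof (cases "[a = b] (mod int p)")
    case True
    then have "plain p a = plain p b" by (simp add: plain_eq_iff)
    then show ?thesis using near_refl[OF near_plain_under_same, of a] by simp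
  next
    case False
    then obtain j where j: "j \<in> {1..half p}"
        "[b = a + 2 * int j] (mod int p) \<or> [a = b + 2 * int j] (mod int p)"
      by (rule ex_index_twice_abs)
    from j(2) show ?thesis
    proof
      assume "[b = a + 2 * int j] (mod int p)"
      then show ?thesis by (rule key[OF sum j(1)])
    next
      assume "[a = b + 2 * int j] (mod int p)"
      then show ?thesis using key[of b a j] sum j(1) by (simp add: near_sym add.commute)
    qed
  qed
qed

text \<open>Here the step that can be missing starts at \<open>- int j\<close>, which makes the sum
  0.\<close>

lemma near_under_under: "near_IT (under p a) (under p b)"
proof (cases "[a + b = 0] (mod int p)")
  case True
  then show ?thesis by (rule near_under_opposite)
next
  case sum: False
  have key: "near_IT (under p a) (under p b)"
    if "\<not> [a + b = 0] (mod int p)" "j \<in> {1..half p}" "[b = a + 2 * int j] (mod int p)" for a b j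
  proof -
    have "\<not> [a = - int j] (mod int p)"
    proof
      assume "[a = - int j] (mod int p)"
      then have "[a + (a + 2 * int j) = - int j + (- int j + 2 * int j)] (mod int p)"
        by (intro cong_add cong_refl)
      then have "[a + (a + 2 * int j) = 0] (mod int p)" by simp
      then show False
        using that cong_add[OF cong_refl that(3)] cong_trans by blast
    qed
    then show ?thesis
      using near_succ2(2)[of j a] that by (simp flip: under_eq_iff)
  qed
  show ?thesis
  proof (cases "[a = b] (mod int p)")
    case True
    then have "under p a = under p b" by (simp add: under_eq_iff)
    then show ?thesis using near_refl[OF near_sym[OF near_plain_under_same], of a] by simp
  next
    case False
    then obtain j where j: "j \<in> {1..half p}"
        "[b = a + 2 * int j] (mod int p) \<or> [a = b + 2 * int j] (mod int p)"
      by (rule ex_index_twice_abs)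
    from j(2) show ?thesis
    proof
      assume "[b = a + 2 * int j] (mod int p)"
      then show ?thesis by (rule key[OF sum j(1)])
    next
      assume "[a = b + 2 * int j] (mod int p)"
      then show ?thesis using key[of b a j] sum j(1) by (simp add: near_sym add.commute)
    qed
  qed
qed

section \<open>Length, letters and conclusion\<close>

lemma length_I_seq: "length (I_seq p) = p * (p - 1)"
proof -
  \<comment> \<open>The two parts of each cycle are regrouped by index; reversing the second half of
    I leaves the sum unchanged.\<close>
  have "length (I_seq p) = (\<Sum>j\<leftarrow>[1..<half p + 1]. length (J_seq p j) + length (J_hat_seq p j))"
    by (simp add: I_seq_def length_concat o_def sum_list_addf sum_list_rev flip: rev_map del: upt_Suc)
  also have "\<dots> = (\<Sum>j\<leftarrow>[1..<half p + 1]. 2 * p)"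
  proof (intro arg_cong[where f = sum_list] map_cong refl)
    fix j assume "j \<in> set [1..<half p + 1]"
    then have "r_index p j < 2 * p" by (intro r_index) auto
    then show "length (J_seq p j) + length (J_hat_seq p j) = 2 * p"
      by (simp add: J_seq_def J_hat_seq_def I_first_def I_second_def)
  qed
  also have "\<dots> = p * (2 * half p)"
    by (simp add: sum_list_triv del: upt_Suc)
  finally show ?thesis using two_half by simp
qed

lemma set_IT_subset: "set (I_seq p @ T_swapped p) \<subseteq> alphabet p"
proof -
  have x: "x_term p j m \<in> alphabet p" and t: "t_term p i \<in> alphabet p" for i j m
    using p_gt_2 by (simp_all add: x_term_def t_term_def plain_in_alphabet under_in_alphabet)
  have "set (T_swapped p) \<subseteq> alphabet p"
    using t by (auto simp: in_set_conv_nth length_T_swapped T_swapped_nth)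
  then show ?thesis
    using x by (auto simp: I_seq_def J_seq_def J_hat_seq_def I_first_def I_second_def
        split: if_splits)
qed

lemma two_radius_sequence_IT: "two_radius_sequence (alphabet p) (I_seq p @ T_swapped p)"
  unfolding two_radius_sequence_iff_near
proof (intro conjI ballI set_IT_subset)
  fix a b assume "a \<in> alphabet p" "b \<in> alphabet p"
  then show "near_IT a b"
    by (elim alphabet_cases)
      (simp_all add: near_plain_plain near_plain_under near_sym[OF near_plain_under]
        near_under_under)
qed

end

theorem theorem4:
  fixes p :: nat
  assumes "prime p" and "p > 2"
  shows "card (alphabet p) = 2 * p
    \<and> length (I_seq p @ T_swapped p) = p ^ 2 + p
    \<and> two_radius_sequence (alphabet p) (I_seq p @ T_swapped p)"
proof (intro conjI)
  have "p * (p - 1) + 2 * p = p ^ 2 + p"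
    using assms(2) by (cases p) (auto simp: power2_eq_square)
  then show "length (I_seq p @ T_swapped p) = p ^ 2 + p"
    using length_I_seq[OF assms] length_T_swapped[OF assms] by simp
qed (use assms in \<open>auto intro: card_alphabet two_radius_sequence_IT\<close>)

end
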